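(* Let $d \ge 2$. There exists a translation-invariant distribution for the initial configuration $(C_0(x);\, x\in\mathbb{Z}^d)$ (that is, a distribution on $[0,\infty]^{\mathbb{Z}^d}$ invariant under all translations of $\mathbb{Z}^d$) such that, for the distributed clustering process $(C_n)_{n\ge 0}$ started from this initial configuration, for each $x\in\mathbb{Z}^d$ the limit $C_\infty(x)=\lim_{n\to\infty}C_n(x)$ exists almost surely and $$\mathbb{E}\left[C_\infty(x)\right] < \mathbb{E}\left[C_0(x)\right].$$
   Context: Write $\mathbb{Z}^d$ also for the graph with vertex set $\mathbb{Z}^d$ in which $x,y$ are adjacent iff $|x-y|=1$, where $|\cdot|$ is the $1$-norm. Distributed clustering process: to each $x\in\mathbb{Z}^d$ is assigned a random initial amount of resource $C_0(x)\in[0,\infty]$; the family $(C_0(x);x\in\mathbb{Z}^d)$ is the initial configuration and is not assumed independent. The evolution is defined recursively for $n\ge 0$. Given the configuration $(C_n(x);x\in\mathbb{Z}^d)$ at time $n$, let $N(x)=\{y\in\mathbb{Z}^d: |x-y|\le 1\}$ (which includes $x$) and $M_n(x)=\{y\in N(x): C_n(y)=\max_{z\in N(x)}C_n(z)\}$. Let $v_n(x)$ be a vertex chosen uniformly at random in $M_n(x)$, independently for each $x$ (tie-breaking choices made with fresh independent randomness at each time step). Put $a_n(x)=x$ if $C_n(x)=0$, and $a_n(x)=v_n(x)$ if $C_n(x)>0$. Then $$C_{n+1}(x)=\sum_{y:\,a_n(y)=x}C_n(y).$$ $C_\infty(x)$ denotes $\lim_{n\to\infty}C_n(x)$ when this limit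 exists. $\mathbb{E}$ denotes expectation with respect to the underlying probability measure (governing both the initial configuration and the tie-breaking); expectations may take the value $+\infty$. *)

theory Defs
  imports "HOL-Probability.Probability"
begin

type_synonym 'd site = "int ^ 'd"
type_synonym 'd config = "'d site \<Rightarrow> ennreal"

definition norm1 :: "'d::finite site \<Rightarrow> int" where
  "norm1 x = (\<Sum>i\<in>UNIV. \<bar>x $ i\<bar>)"

definition nbhd :: "'d::finite site \<Rightarrow> 'd site set" where
  "nbhd x = {y. norm1 (x - y) \<le> 1}"

definition maximizers :: "'d::finite config \<Rightarrow> 'd site \<Rightarrow> 'd site set" where
  "maximizers c x = {y \<in> nbhd x. c y = Max (c ` nbhd x)}"

text \<open>
  The argument \<open>pick\<close> resolves ties: \<open>pick x S\<close> is the element that vertex \<open>x\<close> selects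
  if its set of maximizing neighbours turns out to be \<open>S\<close>.
\<close>

definition target :: "'d::finite config \<Rightarrow> ('d site \<Rightarrow> 'd site set \<Rightarrow> 'd site) \<Rightarrow> 'd site \<Rightarrow> 'd site" where
  "target c pick x = (if c x = 0 then x else pick x (maximizers c x))"

definition cluster_step :: "'d::finite config \<Rightarrow> ('d site \<Rightarrow> 'd site set \<Rightarrow> 'd site) \<Rightarrow> 'd config" where
  "cluster_step c pick x = (\<Sum>y | target c pick y = x. c y)"

primrec clustering ::
  "'d::finite config \<Rightarrow> (nat \<times> 'd site \<times> 'd site set \<Rightarrow> 'd site) \<Rightarrow> nat \<Rightarrow> 'd config" where
  "clustering c w 0 = c"
| "clustering c w (Suc n) = cluster_step (clustering c w n) (\<lambda>x S. w (n, x, S))"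

text \<open>
  The tie-breaking randomness is an independent family indexed by time \<open>n\<close>, vertex \<open>x\<close> and
  nonempty \<open>S \<subseteq> nbhd x\<close>, whose \<open>(n, x, S)\<close> component is uniform on \<open>S\<close>. The sets of maximizers
  at time \<open>n\<close> are determined by the initial configuration and the components with time index
  below \<open>n\<close>; hence, given these, the choices
  \<open>w (n, x, maximizers (clustering c w n) x)\<close> are independent over \<open>x\<close> and uniform on
  \<open>maximizers (clustering c w n) x\<close>. Every \<open>w\<close> in the space of this measure satisfies
  \<open>w (n, x, S) \<in> S\<close>, so the sums in \<^const>\<open>cluster_step\<close> range over finite sets (see
  \<open>finite_target_vimage\<close> below).
\<close>

definition tie_breaking ::
  "(nat \<times> 'd::finite site \<times> 'd site set \<Rightarrow> 'd site) measure" where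
  "tie_breaking = PiM {(n, x, S). S \<noteq> {} \<and> S \<subseteq> nbhd x} (\<lambda>(n, x, S). uniform_count_measure S)"

definition config_algebra :: "'d::finite config measure" where
  "config_algebra = PiM UNIV (\<lambda>_. borel)"

definition translation_invariant_distribution :: "'d::finite config measure \<Rightarrow> bool" where
  "translation_invariant_distribution \<mu> \<longleftrightarrow>
     prob_space \<mu> \<and> sets \<mu> = sets config_algebra \<and>
     (\<forall>t. distr \<mu> config_algebra (\<lambda>c x. c (x + t)) = \<mu>)"

lemma abs_le_norm1: "\<bar>x $ i\<bar> \<le> norm1 x"
  unfolding norm1_def by (rule member_le_sum) auto

lemma finite_nbhd: "finite (nbhd (x :: 'd::finite site))"
proof -
  have "nbhd x \<subseteq> (\<lambda>f. \<chi> i. f i) ` (PiE UNIV (\<lambda>i. {x $ i - 1..x $ i + 1}))"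
  proof
    fix y assume "y \<in> nbhd x"
    then have "\<bar>x $ i - y $ i\<bar> \<le> 1" for i
      using abs_le_norm1[of "x - y" i] by (simp add: nbhd_def)
    then have "x $ i - 1 \<le> y $ i \<and> y $ i \<le> x $ i + 1" for i
      by (smt (verit))
    then show "y \<in> (\<lambda>f. \<chi> i. f i) ` (PiE UNIV (\<lambda>i. {x $ i - 1..x $ i + 1}))"
      by (intro image_eqI[where x = "\<lambda>i. y $ i"]) (auto simp: PiE_UNIV_domain)
  qed
  moreover have "finite (PiE UNIV (\<lambda>i::'d. {x $ i - 1..x $ i + 1}))"
    by (rule finite_PiE) auto
  ultimately show ?thesis
    by (meson finite_imageI finite_subset)
qed

lemma self_in_nbhd: "x \<in> nbhd x"
  by (simp add: nbhd_def norm1_def)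

lemma nbhd_sym: "y \<in> nbhd x \<longleftrightarrow> x \<in> nbhd y"
  by (simp add: nbhd_def norm1_def abs_minus_commute)

lemma maximizers_nonempty: "maximizers c x \<noteq> {}"
proof -
  have "Max (c ` nbhd x) \<in> c ` nbhd x"
    using finite_nbhd self_in_nbhd by (intro Max_in) auto
  then show ?thesis
    by (auto simp: maximizers_def)
qed

lemma maximizers_subset: "maximizers c x \<subseteq> nbhd x"
  by (auto simp: maximizers_def)

lemma tie_breaking_mem:
  assumes "w \<in> space tie_breaking" "S \<noteq> {}" "S \<subseteq> nbhd x"
  shows "w (n, x, S) \<in> S"
proof -
  have "w (n, x, S) \<in> space (uniform_count_measure S)"
    using assms unfolding tie_breaking_def space_PiM
    by (auto dest!: PiE_mem[where x = "(n, x, S)"])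
  then show ?thesis by (simp add: space_uniform_count_measure)
qed

lemma prob_space_tie_breaking: "prob_space tie_breaking"
  unfolding tie_breaking_def
  by (intro prob_space_PiM)
     (auto intro!: prob_space_uniform_count_measure intro: finite_subset[OF _ finite_nbhd])

lemma finite_target_vimage:
  assumes "w \<in> space tie_breaking"
  shows "finite {y. target c (\<lambda>x S. w (n, x, S)) y = x}"
proof (rule finite_subset[OF _ finite_nbhd])
  show "{y. target c (\<lambda>x S. w (n, x, S)) y = x} \<subseteq> nbhd x"
  proof
    fix y assume "y \<in> {y. target c (\<lambda>x S. w (n, x, S)) y = x}"
    then have eq: "target c (\<lambda>x S. w (n, x, S)) y = x" by simp
    have "w (n, y, maximizers c y) \<in> nbhd y"
      using tie_breaking_mem[OF assms maximizers_nonempty maximizers_subset] maximizers_subset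
      by blast
    then have "x \<in> nbhd y"
      using eq self_in_nbhd by (auto simp: target_def split: if_splits)
    then show "y \<in> nbhd x" using nbhd_sym by blast
  qed
qed

end

theory Submission
  imports Defs
begin

text \<open>
  All of the mass can be made to escape to infinity: the initial configuration constructed here
  is translation invariant and not identically zero, and almost surely \<open>C\<^sub>n(x) = 0\<close> for all large
  \<open>n\<close>, whatever the tie-breaking. So the limit has mean \<open>0\<close> while \<open>C\<^sub>0(x)\<close> has positive mean.

  The mass is carried by a forest. Let \<open>P\<close> be a set of sites and \<open>f\<close> a map of \<open>P\<close> to itself sending
  each site to a neighbour, its parent, such that adjacent sites of \<open>P\<close> are always parent and
  child, and such that every site has only finitely many descendants. Let \<open>C\<^sub>0(x)\<close> be the number of
  descendants of \<open>x\<close>, itself included, for \<open>x \<in> P\<close>, and \<open>0\<close> elsewhere. A site without mass never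
  receives any, so the complement of \<open>P\<close> acts as a wall. Inside \<open>P\<close>, the mass of \<open>C\<^sub>n\<close> at \<open>x\<close> is
  the number of descendants of \<open>x\<close> that are at least \<open>n\<close> generations below it. This number grows
  strictly from child to parent as long as it is positive, so every site with mass sends it to
  its parent, without ties, and the description persists at time \<open>n + 1\<close>. Since no site has
  descendants in arbitrarily late generations, the mass at each site is eventually \<open>0\<close>. This
  argument needs only the local comparisons collected in \<open>escaping\<close>, which descendant counts
  satisfy (\<open>escaping_progeny\<close>); its steps are \<open>flow_less_parent\<close>, \<open>clustering_eq_flow\<close> and
  \<open>flow_tendsto_0\<close>.

  A stationary forest of this kind comes from independent labels attached to the hyperplanes
  \<open>x $ a = k\<close>. Keep a label if it is a local maximum along its coordinate and replace it by \<open>0\<close>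
  otherwise; then positive heights are isolated (\<open>peak_isolated\<close>) and, almost surely, still
  unbounded towards \<open>-\<infinity>\<close> (\<open>peaks_unbounded\<close>). In two dimensions the lines of positive height form an
  irregular grid. A path of the forest follows a vertical line upwards or a horizontal line to the
  right, and at a crossing continues along the line of larger height. So the larger height at
  the current site never decreases along a path, and a path ending at \<open>x\<close> cannot have
  crossed a line to the left of or below \<open>x\<close> whose height exceeds those of the two
  lines through \<open>x\<close>: all descendants of \<open>x\<close> lie in a finite box (\<open>forest_past_bounded\<close>). In
  dimension \<open>d > 2\<close> this planar forest is placed in the planes on which the other coordinates
  have positive height; by isolation, no two of these planes are adjacent.

  The mean of \<open>C\<^sub>0(x)\<close> is infinite for this configuration, because by invariance each generation of
  descendants has the same mean size.
\<close>

section \<open>Neighbours in the lattice\<close>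

lemma nbhd_cases:
  assumes "y \<in> nbhd x"
  obtains "y = x" | a where "y = x + axis a 1" | a where "x = y + axis a 1"
proof (cases "y = x")
  case False
  then obtain a where a: "x $ a \<noteq> y $ a" by (metis vec_eq_iff)
  have *: "\<bar>x $ a - y $ a\<bar> + (\<Sum>i\<in>UNIV - {a}. \<bar>x $ i - y $ i\<bar>) \<le> 1"
    using assms by (simp add: nbhd_def norm1_def sum.remove[of UNIV a])
  moreover have "(\<Sum>i\<in>UNIV - {a}. \<bar>x $ i - y $ i\<bar>) \<ge> 0" by (simp add: sum_nonneg)
  ultimately have d: "\<bar>x $ a - y $ a\<bar> = 1" and s: "(\<Sum>i\<in>UNIV - {a}. \<bar>x $ i - y $ i\<bar>) = 0"
    using a by linarith+
  have "x $ i = y $ i" if "i \<noteq> a" for i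
    using s that by (subst (asm) sum_nonneg_eq_0_iff) auto
  then have "y = x + axis a 1 \<or> x = y + axis a 1"
    using d by (auto simp: vec_eq_iff axis_def abs_if split: if_splits)
  then show ?thesis using that by blast
qed (use that in blast)

lemma axis_nbhd: "(x :: 'd::finite site) + axis a 1 \<in> nbhd x"
proof -
  have "(\<Sum>i\<in>UNIV. \<bar>(axis a (1::int) :: int ^ 'd) $ i\<bar>) = (\<Sum>i\<in>UNIV. if i = a then 1 else 0)"
    by (intro sum.cong) (auto simp: axis_def)
  then show ?thesis by (simp add: nbhd_def norm1_def)
qed

lemma nbhd_shift: "nbhd (x + t) = (\<lambda>y. y + t) ` nbhd x"
proof (intro set_eqI iffI)
  fix y assume "y \<in> nbhd (x + t)"
  then show "y \<in> (\<lambda>y. y + t) ` nbhd x"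
    by (intro image_eqI[where x = "y - t"]) (auto simp: nbhd_def algebra_simps)
qed (auto simp: nbhd_def)

section \<open>Configurations whose mass escapes along parents\<close>

definition children :: "'d::finite config \<Rightarrow> 'd site \<Rightarrow> 'd site set" where
  "children c x = {y \<in> nbhd x. 0 < c y \<and> c y < c x}"

text \<open>
  Every site with mass has a neighbour with more mass, its parent, and all its other neighbours have
  less than it. The inequality is what descendant counts in a forest satisfy; it bounds by \<open>c x\<close>
  the number of generations below \<open>x\<close>. All conditions are local comparisons of masses, so that
  they define a measurable set of configurations (\<open>measurable_escaping\<close>), as needed to pass from
  the labels to the law of the configuration.
\<close>
definition escaping :: "'d::finite config \<Rightarrow> bool" where
  "escaping c \<longleftrightarrow> (\<forall>x. c x < \<top> \<and> (0 < c x \<longrightarrow>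
     (\<exists>y\<in>nbhd x. c x < c y \<and> (\<forall>z\<in>nbhd x. z = x \<or> z = y \<or> c z < c x)) \<and>
     1 + sum c (children c x) \<le> c x))"

text \<open>
  The mass present at time \<open>n\<close> if all mass always moves from child to parent, where the
  children are those of the initial configuration.
\<close>
primrec flow :: "'d::finite config \<Rightarrow> nat \<Rightarrow> 'd config" where
  "flow c 0 = c"
| "flow c (Suc n) = (\<lambda>x. sum (flow c n) (children c x))"

lemma finite_children [simp]: "finite (children c x)"
  using finite_nbhd[of x] by (simp add: children_def)

lemma flow_zero: "c x = 0 \<Longrightarrow> flow c n x = 0"
  by (cases n) (auto simp: children_def)

lemma flow_Suc_pos_iff: "0 < flow c (Suc n) x \<longleftrightarrow> (\<exists>y\<in>children c x. 0 < flow c n y)"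
  by (auto simp: zero_less_iff_neq_zero)

text \<open>
  At each step a site with mass loses at least one unit. At time \<open>0\<close> this is the
  inequality in the definition of \<^const>\<open>escaping\<close>; later losses are inherited from the children,
  one of which had mass if the site has mass one step later.
\<close>
lemma flow_decrease:
  assumes "escaping c"
  shows "flow c (Suc n) x + of_bool (0 < flow c n x) \<le> flow c n x"
proof (induction n arbitrary: x)
  case 0
  show ?case
  proof (cases "c x = 0")
    case True
    then show ?thesis using flow_zero[of c x 1] by simp
  next
    case False
    then have "1 + sum c (children c x) \<le> c x"
      using assms by (auto simp: escaping_def zero_less_iff_neq_zero)
    then show ?thesis using False by (simp add: add.commute zero_less_iff_neq_zero)
  qed
next
  case (Suc n)
  have "flow c (Suc (Suc n)) x + of_bool (0 < flow c (Suc n) x)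
      \<le> (\<Sum>y\<in>children c x. flow c (Suc n) y) + (\<Sum>y\<in>children c x. of_bool (0 < flow c n y))"
  proof (cases "0 < flow c (Suc n) x")
    case True
    then obtain y where y: "y \<in> children c x" "0 < flow c n y"
      unfolding flow_Suc_pos_iff by blast
    have "(1::ennreal) \<le> (\<Sum>y\<in>children c x. of_bool (0 < flow c n y))"
      using y member_le_sum[of y "children c x" "\<lambda>y. of_bool (0 < flow c n y) :: ennreal"] by simp
    then show ?thesis using True by (simp add: add_left_mono)
  qed simp
  also have "\<dots> = (\<Sum>y\<in>children c x. flow c (Suc n) y + of_bool (0 < flow c n y))"
    by (simp add: sum.distrib)
  also have "\<dots> \<le> (\<Sum>y\<in>children c x. flow c n y)"
    by (intro sum_mono Suc)
  finally show ?case by simp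
qed

lemma flow_le: 
  assumes "escaping c"
  shows "flow c n x + of_nat n * of_bool (0 < flow c n x) \<le> c x"
proof (induction n)
  case (Suc n)
  note d = flow_decrease[OF assms, of n x]
  show ?case
  proof (cases "0 < flow c (Suc n) x")
    case True
    then have p: "0 < flow c n x"
      using d by (metis add_nonneg_nonneg le_iff_add less_le_trans of_bool_eq_iff zero_le)
    have "flow c (Suc n) x + of_nat (Suc n) * of_bool (0 < flow c (Suc n) x)
        = (flow c (Suc n) x + of_bool (0 < flow c n x)) + of_nat n * of_bool (0 < flow c n x)"
      unfolding of_nat_Suc using True p by (simp add: add.assoc add.commute add.left_commute)
    also have "\<dots> \<le> flow c n x + of_nat n * of_bool (0 < flow c n x)"
      by (rule add_right_mono[OF d])
    finally show ?thesis using Suc by (rule order.trans)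
  qed simp
qed simp

lemma flow_tendsto_0:
  assumes "escaping c"
  shows "(\<lambda>n. flow c n x) \<longlonglongrightarrow> 0"
proof -
  obtain N where N: "c x < of_nat N"
    using assms ennreal_Ex_less_of_nat unfolding escaping_def by blast
  have "flow c n x = 0" if "n \<ge> N" for n
  proof (rule ccontr)
    assume "flow c n x \<noteq> 0"
    then have "of_nat n \<le> flow c n x + of_nat n * of_bool (0 < flow c n x)"
      by (simp add: zero_less_iff_neq_zero)
    also have "\<dots> \<le> c x" by (rule flow_le[OF assms])
    also note N
    finally show False using that by simp
  qed
  then show ?thesis
    by (intro tendsto_eventually) (auto simp: eventually_sequentially)
qed

lemma flow_finite:
  assumes "escaping c"
  shows "flow c n x < \<top>"
proof -
  have "flow c n x \<le> c x"
    using flow_le[OF assms, of n x] by (meson le_iff_add order.trans zero_le)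
  also have "c x < \<top>" using assms by (auto simp: escaping_def)
  finally show ?thesis .
qed

text \<open>
  The parent receives the mass of the child in the next step, although it loses a unit in this
  step; so it must have had more than the child before.
\<close>
lemma flow_less_parent:
  assumes c: "escaping c" and x: "x \<in> children c y" and pos: "0 < flow c n x"
  shows "flow c n x < flow c n y"
proof -
  have le: "flow c n x \<le> flow c (Suc n) y"
    using member_le_sum[OF x, of "flow c n"] by simp
  have p: "0 < flow c n y"
    using flow_decrease[OF c, of n y] le pos
    by (metis le_iff_add less_le_trans order.trans)
  have "flow c n x < flow c n x + 1"
    using flow_finite[OF c, of n x] by (simp add: ennreal_add_left_cancel_less[of _ 0, simplified] less_top)
  also have "\<dots> \<le> flow c (Suc n) y + of_bool (0 < flow c n y)"
    using p le by (simp add: add_right_mono)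
  also have "\<dots> \<le> flow c n y" by (rule flow_decrease[OF c])
  finally show ?thesis .
qed

text \<open>
  Ties never occur: every choice function moves the mass of a site to its parent.
\<close>
lemma maximizers_flow:
  assumes c: "escaping c" and pos: "0 < flow c n x"
  shows "\<exists>y. x \<in> children c y \<and> maximizers (flow c n) x = {y}"
proof -
  have "c x \<noteq> 0" using pos flow_zero[of c x n] by auto
  then have cx: "0 < c x" by (simp add: zero_less_iff_neq_zero)
  then obtain y where y: "y \<in> nbhd x" "c x < c y"
      "\<And>z. z \<in> nbhd x \<Longrightarrow> z = x \<or> z = y \<or> c z < c x"
    using c unfolding escaping_def by blast
  have xy: "x \<in> children c y" using y cx nbhd_sym by (auto simp: children_def)
  have less: "flow c n z < flow c n y" if z: "z \<in> nbhd x" "z \<noteq> y" for z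
  proof (cases "flow c n z = 0 \<or> z = x")
    case True
    then show ?thesis using flow_less_parent[OF c xy pos] pos by auto
  next
    case False
    then have "z \<in> children c x"
      using y(3)[OF z(1)] z flow_zero[of c z n] by (auto simp: children_def zero_less_iff_neq_zero)
    then have "flow c n z < flow c n x"
      using False by (intro flow_less_parent[OF c]) (auto simp: zero_less_iff_neq_zero)
    then show ?thesis using flow_less_parent[OF c xy pos] by (rule less_trans)
  qed
  have "Max (flow c n ` nbhd x) = flow c n y"
    using y(1) less by (intro Max_eqI) (auto simp: finite_nbhd intro: less_imp_le)
  then have "maximizers (flow c n) x = {y}"
    using y(1) less unfolding maximizers_def by (auto dest: less_imp_neq)
  with xy show ?thesis by blast
qed

lemma children_disjoint:
  assumes c: "escaping c" and x: "x \<in> children c y" "x \<in> children c z"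
  shows "y = z"
proof -
  have "0 < c x" using x by (auto simp: children_def)
  then obtain p where "\<And>z. z \<in> nbhd x \<Longrightarrow> z = x \<or> z = p \<or> c z < c x"
    using c unfolding escaping_def by blast
  then show ?thesis using x nbhd_sym by (metis (no_types, lifting) children_def mem_Collect_eq less_asym)
qed

lemma cluster_step_flow:
  assumes c: "escaping c" and w: "w \<in> space tie_breaking"
  shows "cluster_step (flow c n) (\<lambda>x S. w (n, x, S)) = flow c (Suc n)"
proof
  fix x
  let ?t = "target (flow c n) (\<lambda>x S. w (n, x, S))"
  have t: "x \<in> children c (?t x)" if pos: "0 < flow c n x" for x
  proof -
    obtain y where y: "x \<in> children c y" "maximizers (flow c n) x = {y}"
      using maximizers_flow[OF c pos] by blast
    then have "w (n, x, {y}) \<in> {y}"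
      by (intro tie_breaking_mem[OF w]) (auto simp: children_def nbhd_sym)
    then show ?thesis using y pos by (auto simp: target_def)
  qed
  have "cluster_step (flow c n) (\<lambda>x S. w (n, x, S)) x = sum (flow c n) {y. ?t y = x}"
    by (simp add: cluster_step_def)
  also have "\<dots> = sum (flow c n) {y \<in> children c x. flow c n y \<noteq> 0}"
  proof (rule sum.mono_neutral_right)
    show "finite {y. ?t y = x}" by (rule finite_target_vimage[OF w])
    show "{y \<in> children c x. flow c n y \<noteq> 0} \<subseteq> {y. ?t y = x}"
      using t children_disjoint[OF c] by (auto simp: zero_less_iff_neq_zero)
    show "\<forall>y\<in>{y. ?t y = x} - {y \<in> children c x. flow c n y \<noteq> 0}. flow c n y = 0"
      using t by (auto simp: zero_less_iff_neq_zero)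
  qed
  also have "\<dots> = flow c (Suc n) x"
    by (auto intro: sum.mono_neutral_left)
  finally show "cluster_step (flow c n) (\<lambda>x S. w (n, x, S)) x = flow c (Suc n) x" .
qed

lemma clustering_eq_flow:
  assumes "escaping c" "w \<in> space tie_breaking"
  shows "clustering c w n = flow c n"
  by (induction n) (simp_all del: flow.simps(2) add: cluster_step_flow[OF assms])

section \<open>Descendant counts of induced forests\<close>

text \<open>
  The number of descendants \<open>n\<close> generations below a site. The recursion over neighbours, rather than
  the cardinality of \<open>{y \<in> P. (f ^^ n) y = x}\<close>, makes measurability in \<open>P\<close> and \<open>f\<close> an easy induction.
\<close>
primrec generation :: "'d::finite site set \<Rightarrow> ('d site \<Rightarrow> 'd site) \<Rightarrow> nat \<Rightarrow> 'd config" where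
  "generation P f 0 = (\<lambda>x. of_bool (x \<in> P))"
| "generation P f (Suc n) = (\<lambda>x. \<Sum>y\<in>nbhd x. if y \<in> P \<and> f y = x then generation P f n y else 0)"

definition progeny :: "'d::finite site set \<Rightarrow> ('d site \<Rightarrow> 'd site) \<Rightarrow> 'd config" where
  "progeny P f x = (\<Sum>n. generation P f n x)"

locale induced_forest =
  fixes P :: "'d::finite site set" and f :: "'d site \<Rightarrow> 'd site"
  assumes closed: "x \<in> P \<Longrightarrow> f x \<in> P"
    and adjacent: "x \<in> P \<Longrightarrow> f x \<in> nbhd x"
    and induced: "x \<in> P \<Longrightarrow> y \<in> P \<Longrightarrow> y \<in> nbhd x \<Longrightarrow> y = x \<or> y = f x \<or> x = f y"
    and finite_past: "\<exists>n. \<forall>y\<in>P. (f ^^ n) y \<noteq> x"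
begin

lemma funpow_closed: "x \<in> P \<Longrightarrow> (f ^^ n) x \<in> P"
  by (induction n) (auto intro: closed)

lemma generation_finite: "generation P f n x < \<top>"
proof (induction n arbitrary: x)
  case (Suc n)
  have "generation P f (Suc n) x \<le> sum (generation P f n) (nbhd x)"
    by (auto intro: sum_mono)
  also have "\<dots> < \<top>"
    using Suc by (simp add: finite_nbhd less_top[symmetric])
  finally show ?case .
qed (simp add: of_bool_def)

lemma generation_nonzero: "generation P f n x \<noteq> 0 \<Longrightarrow> \<exists>y\<in>P. (f ^^ n) y = x"
proof (induction n arbitrary: x)
  case (Suc n)
  then have "(\<Sum>y\<in>nbhd x. if y \<in> P \<and> f y = x then generation P f n y else 0) \<noteq> 0"
    by simp
  then obtain y where "(if y \<in> P \<and> f y = x then generation P f n y else 0) \<noteq> 0"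
    by (rule sum.not_neutral_contains_not_neutral)
  then have "y \<in> P" "f y = x" "generation P f n y \<noteq> 0"
    by (auto split: if_splits)
  with Suc.IH[of y] show ?case by auto
qed (auto split: if_splits)

lemma progeny_finite: "progeny P f x < \<top>"
proof -
  obtain N where N: "\<forall>y\<in>P. (f ^^ N) y \<noteq> x" using finite_past by blast
  have "generation P f n x = 0" if "n \<ge> N" for n
  proof (rule ccontr)
    assume "generation P f n x \<noteq> 0"
    then obtain y where y: "y \<in> P" "(f ^^ n) y = x" using generation_nonzero by blast
    have "(f ^^ N) ((f ^^ (n - N)) y) = x"
      using y(2) that by (metis funpow_add le_add_diff_inverse o_apply)
    then show False using N funpow_closed[OF y(1)] by blast
  qed
  then have "progeny P f x = (\<Sum>n<N. generation P f n x)"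
    unfolding progeny_def by (intro suminf_finite) auto
  then show ?thesis using generation_finite by simp
qed

lemma finite_preimage: "finite {y. y \<in> P \<and> f y = x}"
  by (rule finite_subset[OF _ finite_nbhd[of x]]) (use adjacent nbhd_sym in blast)

lemma progeny_unfold:
  "progeny P f x = of_bool (x \<in> P) + (\<Sum>y | y \<in> P \<and> f y = x. progeny P f y)"
proof -
  have "progeny P f x = generation P f 0 x + (\<Sum>n. generation P f (Suc n) x)"
    unfolding progeny_def
    using suminf_offset[of "\<lambda>n. generation P f n x" 1] by (simp add: summableI)
  also have "(\<lambda>n. generation P f (Suc n) x) = (\<lambda>n. \<Sum>y | y \<in> P \<and> f y = x. generation P f n y)"
  proof
    fix n
    have "generation P f (Suc n) x = (\<Sum>y\<in>nbhd x \<inter> {y. y \<in> P \<and> f y = x}. generation P f n y)"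
      by (simp add: sum.inter_restrict[OF finite_nbhd])
    also have "nbhd x \<inter> {y. y \<in> P \<and> f y = x} = {y. y \<in> P \<and> f y = x}"
      using adjacent nbhd_sym by blast
    finally show "generation P f (Suc n) x = (\<Sum>y | y \<in> P \<and> f y = x. generation P f n y)" .
  qed
  also have "(\<Sum>n. \<Sum>y | y \<in> P \<and> f y = x. generation P f n y) = (\<Sum>y | y \<in> P \<and> f y = x. progeny P f y)"
    unfolding progeny_def by (intro suminf_sum summableI)
  finally show ?thesis by simp
qed

lemma progeny_pos_iff: "0 < progeny P f x \<longleftrightarrow> x \<in> P"
proof -
  have "(\<Sum>y | y \<in> P \<and> f y = x. progeny P f y) = 0" if "x \<notin> P"
    using that closed by (intro sum.neutral) blast
  then show ?thesis
    using progeny_unfold[of x] by (cases "x \<in> P") (auto simp: add_pos_nonneg)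
qed

lemma progeny_less: 
  assumes "x \<in> P"
  shows "progeny P f x < progeny P f (f x)"
proof -
  have "progeny P f x < 1 + progeny P f x"
    using progeny_finite[of x] by (simp add: ennreal_add_left_cancel_less[of _ 0, simplified] less_top add.commute)
  also have "\<dots> \<le> 1 + (\<Sum>y | y \<in> P \<and> f y = f x. progeny P f y)"
    using assms by (intro add_left_mono member_le_sum finite_preimage) auto
  also have "\<dots> = progeny P f (f x)"
    using closed[OF assms] progeny_unfold[of "f x"] by simp
  finally show ?thesis .
qed

lemma children_progeny: "children (progeny P f) x = {y. y \<in> P \<and> f y = x}"
proof (intro set_eqI iffI)
  fix y assume y: "y \<in> children (progeny P f) x"
  then have yx: "y \<in> P" "y \<in> nbhd x" "progeny P f y < progeny P f x"
    by (auto simp: children_def progeny_pos_iff)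
  moreover from yx have "x \<in> P" by (metis progeny_pos_iff zero_le order.strict_trans1)
  ultimately have "y = x \<or> y = f x \<or> x = f y" by (intro induced)
  then show "y \<in> {y. y \<in> P \<and> f y = x}"
    using yx progeny_less[OF \<open>x \<in> P\<close>] by (auto dest: less_asym)
next
  fix y assume "y \<in> {y. y \<in> P \<and> f y = x}"
  then show "y \<in> children (progeny P f) x"
    using adjacent progeny_less nbhd_sym by (auto simp: children_def progeny_pos_iff)
qed

lemma escaping_progeny: "escaping (progeny P f)"
  unfolding escaping_def
proof (intro allI conjI impI)
  fix x
  show "progeny P f x < \<top>" by (rule progeny_finite)
  assume "0 < progeny P f x"
  then have x: "x \<in> P" by (simp add: progeny_pos_iff)
  show "1 + sum (progeny P f) (children (progeny P f) x) \<le> progeny P f x"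
    using x progeny_unfold[of x] by (simp add: children_progeny)
  show "\<exists>y\<in>nbhd x. progeny P f x < progeny P f y \<and>
      (\<forall>z\<in>nbhd x. z = x \<or> z = y \<or> progeny P f z < progeny P f x)"
  proof (intro bexI[of _ "f x"] conjI ballI progeny_less x adjacent)
    fix z assume z: "z \<in> nbhd x"
    show "z = x \<or> z = f x \<or> progeny P f z < progeny P f x"
    proof (cases "z \<in> P")
      case True
      then show ?thesis using induced[OF x True z] progeny_less[of z] by auto
    next
      case False
      then have "progeny P f z = 0" using progeny_pos_iff[of z] by (simp add: zero_less_iff_neq_zero)
      then show ?thesis using x progeny_pos_iff[of x] by simp
    qed
  qed
qed

end

section \<open>A forest built from hyperplane labels\<close>

definition peak :: "('d \<times> int \<Rightarrow> nat) \<Rightarrow> 'd \<Rightarrow> int \<Rightarrow> nat" where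
  "peak u a k = (if u (a, k - 1) < u (a, k) \<and> u (a, k + 1) \<le> u (a, k) then u (a, k) else 0)"

lemma peak_isolated: "0 < peak u a k \<Longrightarrow> peak u a (k + 1) = 0"
  by (auto simp: peak_def split: if_splits)

text \<open>
  Between two zeros the labels reach their maximum at an interior place. The first such place is
  a peak, and arbitrarily high labels between zeros give arbitrarily high peaks.
\<close>
lemma peaks_unbounded:
  assumes high: "\<And>i m. \<exists>j<i. m < u (a, j)" and low: "\<And>i. \<exists>j<i. u (a, j) = 0"
  shows "\<exists>j<i. m < peak u a j"
proof -
  obtain r where r: "r < i" "u (a, r) = 0" using low by blast
  obtain h where h: "h < r" "m < u (a, h)" using high by blast
  obtain l where l: "l < h" "u (a, l) = 0" using low by blast
  define top where "top = Max ((\<lambda>j. u (a, j)) ` {l..r})"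
  \<comment> \<open>the leftmost maximum, so that the ascent from the left is strict as a peak requires\<close>
  define j where "j = (LEAST n. u (a, l + int n) = top)"
  have le_top: "u (a, k) \<le> top" if "l \<le> k" "k \<le> r" for k
    unfolding top_def using that by (intro Max_ge) auto
  have "top \<in> (\<lambda>j. u (a, j)) ` {l..r}"
    unfolding top_def using l h by (intro Max_in) auto
  then obtain k where k: "l \<le> k" "k \<le> r" "u (a, k) = top" by auto
  then have ex: "u (a, l + int (nat (k - l))) = top" by simp
  have j: "u (a, l + int j) = top"
    unfolding j_def using ex by (rule LeastI)
  have "j \<le> nat (k - l)" unfolding j_def using ex by (rule Least_le)
  then have jr: "l + int j \<le> r" using k by linarith
  have m: "m < top" using le_top[of h] l h by linarith
  have "j \<noteq> 0" using j l m by (intro notI) simp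
  then obtain j' where j': "j = Suc j'" by (cases j) auto
  have "l + int j \<noteq> r" using j r m by auto
  then have jr': "l + int j < r" using jr by simp
  have "u (a, l + int j') \<noteq> top"
    using not_less_Least[of j' "\<lambda>n. u (a, l + int n) = top"] j' unfolding j_def by simp
  moreover have "u (a, l + int j') \<le> top" using jr j' by (intro le_top) auto
  ultimately have "u (a, l + int j - 1) < u (a, l + int j)" unfolding j using j' by simp
  moreover have "u (a, l + int j + 1) \<le> u (a, l + int j)"
    unfolding j using jr' by (intro le_top) auto
  ultimately have "peak u a (l + int j) = top" using j by (simp add: peak_def)
  then show ?thesis using m jr' r by (intro exI[of _ "l + int j"]) simp
qed

text \<open>
  Through \<open>x\<close> run a line in direction \<open>p\<close> (the one with \<open>q\<close>-coordinate \<open>x $ q\<close>, of height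
  \<^term>\<open>peak u q (x $ q)\<close>) and a line in direction \<open>q\<close> (of height \<^term>\<open>peak u p (x $ p)\<close>); the
  step follows the higher of the two.
\<close>
definition forest_step :: "'d::finite \<Rightarrow> 'd \<Rightarrow> ('d \<times> int \<Rightarrow> nat) \<Rightarrow> 'd site \<Rightarrow> 'd site" where
  "forest_step p q u x =
    (if peak u p (x $ p) \<le> peak u q (x $ q) then x + axis p 1 else x + axis q 1)"

text \<open>
  The last two conditions delete, from a line of positive height, the first site beyond each crossing
  at which paths turn away from that line. This deletion is what makes the forest induced: without it
  the crossing and the site beyond it would be adjacent although no path steps between them. The
  conditions also exclude sites through which no line of positive height passes, since no height
  lies below \<open>0\<close>.
\<close>
definition forest_sites :: "'d::finite \<Rightarrow> 'd \<Rightarrow> ('d \<times> int \<Rightarrow> nat) \<Rightarrow> 'd site set" where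
  "forest_sites p q u = {x.
    (\<forall>a. a \<noteq> p \<and> a \<noteq> q \<longrightarrow> 0 < peak u a (x $ a)) \<and>
    (peak u q (x $ q) = 0 \<longrightarrow> peak u q (x $ q - 1) < peak u p (x $ p)) \<and>
    (peak u p (x $ p) = 0 \<longrightarrow> peak u p (x $ p - 1) \<le> peak u q (x $ q))}"

text \<open>
  Two adjacent sites along \<open>p\<close> do not both lie on lines in direction \<open>q\<close> of positive height, by
  isolation. So if the first site stepped in direction \<open>q\<close> instead, the last condition on forest
  sites would exclude the second. Adjacency along \<open>q\<close> is analogous, and adjacency in any other
  direction contradicts isolation at once.
\<close>
lemma forest_step_axis:
  assumes pq: "p \<noteq> q" and x: "x \<in> forest_sites p q u" "x + axis a 1 \<in> forest_sites p q u"
  shows "forest_step p q u x = x + axis a 1"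
proof -
  let ?i = "x $ p" and ?j = "x $ q"
  consider "a \<noteq> p" "a \<noteq> q" | "a = p" | "a = q" by blast
  then show ?thesis
  proof cases
    case 1
    then have "0 < peak u a (x $ a)" "0 < peak u a (x $ a + 1)"
      using x by (auto simp: forest_sites_def axis_def)
    then show ?thesis using peak_isolated[of u a "x $ a"] by simp
  next
    case 2
    have "peak u p ?i \<le> peak u q ?j"
    proof (rule ccontr)
      assume *: "\<not> peak u p ?i \<le> peak u q ?j"
      then have "peak u p (?i + 1) = 0" by (intro peak_isolated) simp
      then have "peak u p ?i \<le> peak u q ?j"
        using x(2) pq 2 by (simp add: forest_sites_def axis_def)
      with * show False ..
    qed
    then show ?thesis using 2 by (simp add: forest_step_def)
  next
    case 3
    have "\<not> peak u p ?i \<le> peak u q ?j"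
    proof
      assume *: "peak u p ?i \<le> peak u q ?j"
      have "peak u q ?j \<noteq> 0"
        using x(1) * by (auto simp: forest_sites_def)
      then have "peak u q (?j + 1) = 0" by (intro peak_isolated) simp
      then have "peak u q ?j < peak u p ?i"
        using x(2) pq 3 by (simp add: forest_sites_def axis_def)
      with * show False by simp
    qed
    then show ?thesis using 3 by (simp add: forest_step_def)
  qed
qed

lemma forest_step_closed:
  assumes pq: "p \<noteq> q" and x: "x \<in> forest_sites p q u"
  shows "forest_step p q u x \<in> forest_sites p q u"
proof (cases "peak u p (x $ p) \<le> peak u q (x $ q)")
  case True
  moreover have "peak u q (x $ q) \<noteq> 0"
    using x True by (auto simp: forest_sites_def)
  ultimately show ?thesis
    using x pq by (auto simp: forest_step_def forest_sites_def axis_def)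
next
  case False
  then show ?thesis
    using x pq by (auto simp: forest_step_def forest_sites_def axis_def)
qed

text \<open>
  Since the larger height never decreases along a path, a path to \<open>x\<close> never visits a hyperplane
  \<open>y $ p = i\<close> or \<open>y $ q = j\<close> of height larger than both heights at \<open>x\<close>. Each step decreases
  the coordinates by at most \<open>1\<close> when read backwards, so the path cannot jump over it either.
\<close>
lemma forest_past_bounded:
  fixes x :: "'d::finite site"
  assumes pq: "p \<noteq> q"
    and i: "i < x $ p" "max (peak u p (x $ p)) (peak u q (x $ q)) < peak u p i"
    and j: "j < x $ q" "max (peak u p (x $ p)) (peak u q (x $ q)) < peak u q j"
    and y: "(forest_step p q u ^^ n) y = x"
  shows "i < y $ p \<and> j < y $ q \<and> y $ p + y $ q + int n = x $ p + x $ q \<and>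
    max (peak u p (y $ p)) (peak u q (y $ q)) \<le> max (peak u p (x $ p)) (peak u q (x $ q))"
  using y
proof (induction n arbitrary: y)
  case 0
  then show ?case using i j by simp
next
  case (Suc n)
  let ?z = "forest_step p q u y"
  have "(forest_step p q u ^^ n) ?z = x" using Suc.prems by (simp add: funpow_swap1)
  note IH = Suc.IH[OF this]
  have yz: "max (peak u p (y $ p)) (peak u q (y $ q)) \<le> max (peak u p (?z $ p)) (peak u q (?z $ q))"
    "y $ p + y $ q + 1 = ?z $ p + ?z $ q" "?z $ p - 1 \<le> y $ p" "?z $ q - 1 \<le> y $ q"
    using pq by (auto simp: forest_step_def axis_def)
  have top: "max (peak u p (y $ p)) (peak u q (y $ q)) \<le> max (peak u p (x $ p)) (peak u q (x $ q))"
    using yz(1) IH by linarith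
  moreover have "y $ p \<noteq> i" using top i(2) by auto
  moreover have "y $ q \<noteq> j" using top j(2) by auto
  ultimately show ?case using yz IH by auto
qed

lemma induced_forest_peaks:
  fixes p q :: "'d::finite"
  assumes pq: "p \<noteq> q" and peaks: "\<And>a i m. \<exists>j<i. m < peak u a j"
  shows "induced_forest (forest_sites p q u) (forest_step p q u)"
proof
  fix x y :: "'d site"
  assume x: "x \<in> forest_sites p q u"
  show "forest_step p q u x \<in> forest_sites p q u" by (rule forest_step_closed[OF pq x])
  show "forest_step p q u x \<in> nbhd x" by (simp add: forest_step_def axis_nbhd)
  assume "y \<in> forest_sites p q u" "y \<in> nbhd x"
  with x show "y = x \<or> y = forest_step p q u x \<or> x = forest_step p q u y"
    by (metis nbhd_cases forest_step_axis[OF pq])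
next
  fix x :: "'d site"
  obtain i where i: "i < x $ p" "max (peak u p (x $ p)) (peak u q (x $ q)) < peak u p i"
    using peaks by blast
  obtain j where j: "j < x $ q" "max (peak u p (x $ p)) (peak u q (x $ q)) < peak u q j"
    using peaks by blast
  \<comment> \<open>each step raises the sum of the two coordinates by one, and they exceed \<open>i\<close> and \<open>j\<close>\<close>
  let ?n = "nat (x $ p + x $ q - i - j)"
  have "(forest_step p q u ^^ ?n) y \<noteq> x" for y
    using forest_past_bounded[OF pq i j, of ?n y] i j by auto
  then show "\<exists>n. \<forall>y\<in>forest_sites p q u. (forest_step p q u ^^ n) y \<noteq> x" by blast
qed

section \<open>Translations\<close>

definition forest_config :: "'d::finite \<Rightarrow> 'd \<Rightarrow> ('d \<times> int \<Rightarrow> nat) \<Rightarrow> 'd config" where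
  "forest_config p q u = progeny (forest_sites p q u) (forest_step p q u)"

definition shift_labels :: "'d::finite site \<Rightarrow> ('d \<times> int \<Rightarrow> nat) \<Rightarrow> 'd \<times> int \<Rightarrow> nat" where
  "shift_labels t u = (\<lambda>(a, k). u (a, k + t $ a))"

lemma peak_shift: "peak (shift_labels t u) a k = peak u a (k + t $ a)"
  by (simp add: peak_def shift_labels_def algebra_simps)

lemma forest_sites_shift: "x \<in> forest_sites p q (shift_labels t u) \<longleftrightarrow> x + t \<in> forest_sites p q u"
  by (simp add: forest_sites_def peak_shift algebra_simps)

lemma forest_step_shift: "forest_step p q u (x + t) = forest_step p q (shift_labels t u) x + t"
  by (simp add: forest_step_def peak_shift algebra_simps)

text \<open>
  With the forests of the shifted and of the original labels for \<open>P\<close> and \<open>Q\<close>, this is the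
  equivariance by which the configuration inherits the invariance of the labels.
\<close>
lemma generation_shift:
  assumes "\<And>x. x \<in> P \<longleftrightarrow> x + t \<in> Q" "\<And>x. g (x + t) = f x + t"
  shows "generation P f n x = generation Q g n (x + t)"
proof (induction n arbitrary: x)
  case (Suc n)
  then show ?case
    by (simp add: nbhd_shift sum.reindex inj_on_def assms cong: if_cong)
qed (simp add: assms)

lemma forest_config_shift: "forest_config p q (shift_labels t u) x = forest_config p q u (x + t)"
  unfolding forest_config_def progeny_def
  by (intro suminf_cong generation_shift forest_sites_shift forest_step_shift)

section \<open>Random labels\<close>

text \<open>
  The geometric distribution is used only because it gives positive probability to
  every natural number.
\<close>
definition label_measure :: "('d \<times> int \<Rightarrow> nat) measure" where
  "label_measure = PiM UNIV (\<lambda>_. measure_pmf (geometric_pmf (1/2)))"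

interpretation labels: product_prob_space "\<lambda>_. measure_pmf (geometric_pmf (1/2))" UNIV
  by standard

lemma prob_space_label_measure: "prob_space label_measure"
  unfolding label_measure_def by (rule labels.prob_space_axioms)

lemma measurable_label [measurable]: "(\<lambda>u. u i) \<in> measurable label_measure (count_space UNIV)"
proof -
  have "(\<lambda>u. u i) \<in> measurable label_measure (measure_pmf (geometric_pmf (1/2)))"
    unfolding label_measure_def by (rule measurable_component_singleton) simp
  then show ?thesis by (simp cong: measurable_cong_sets)
qed

text \<open>
  The event of missing \<open>A\<close> at the \<open>n\<close> places next below \<open>i\<close> has probability \<open>r\<^sup>n\<close>, where
  \<open>r < 1\<close> is the probability that a single label misses \<open>A\<close>.
\<close>
lemma AE_label_hits:
  assumes "v \<in> A"
  shows "AE u in label_measure. \<exists>j<i. u (a, j) \<in> A"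
proof -
  let ?p = "geometric_pmf (1/2)"
  define r where "r = measure_pmf.prob ?p (- A)"
  let ?N = "{u \<in> space label_measure. \<not> (\<exists>j<i. u (a, j) \<in> A)}"
  have "v \<in> set_pmf ?p" by (simp add: set_pmf_geometric)
  then have "0 < measure_pmf.prob ?p A" using assms by (metis measure_pmf_posI)
  then have r: "0 \<le> r" "r < 1"
    using measure_pmf.prob_compl[of A ?p] by (auto simp: r_def Compl_eq_Diff_UNIV)
  have le: "emeasure label_measure ?N \<le> ennreal (r ^ n)" for n
  proof -
    define J where "J = (\<lambda>k. (a, i - 1 - int k)) ` {..<n}"
    have card: "card J = n" unfolding J_def by (subst card_image) (auto simp: inj_on_def)
    have "?N \<subseteq> {u \<in> space label_measure. \<forall>k\<in>J. u k \<in> - A}" by (auto simp: J_def)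
    then have "emeasure label_measure ?N \<le> emeasure label_measure {u \<in> space label_measure. \<forall>k\<in>J. u k \<in> - A}"
      by (rule emeasure_mono) (simp add: J_def)
    also have "\<dots> = (\<Prod>k\<in>J. emeasure ?p (- A))"
      unfolding label_measure_def by (rule labels.emeasure_PiM_Collect) (auto simp: J_def)
    also have "\<dots> = ennreal (r ^ n)"
      using r by (simp add: card r_def measure_pmf.emeasure_eq_measure ennreal_power)
    finally show ?thesis .
  qed
  have "(\<lambda>n. ennreal (r ^ n)) \<longlonglongrightarrow> ennreal 0"
    using r by (intro tendsto_ennrealI LIMSEQ_power_zero) simp
  then have "emeasure label_measure ?N \<le> 0"
    using le by (intro LIMSEQ_le_const[where X = "\<lambda>n. ennreal (r ^ n)"]) auto
  then show ?thesis by (subst AE_iff_measurable[OF _ refl]) auto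
qed

lemma AE_induced_forest:
  fixes p q :: "'d::finite"
  assumes "p \<noteq> q"
  shows "AE u in label_measure. induced_forest (forest_sites p q u) (forest_step p q u)"
proof -
  have "AE u in label_measure. (\<forall>(a :: 'd) i m. \<exists>j<i. u (a, j) \<in> {m<..}) \<and> (\<forall>(a :: 'd) i. \<exists>j<i. u (a, j) \<in> {0})"
    unfolding AE_conj_iff AE_all_countable
    by (intro conjI allI AE_label_hits) auto
  then show ?thesis
  proof eventually_elim
    case (elim u)
    then show ?case
      by (intro induced_forest_peaks assms peaks_unbounded) auto
  qed
qed

lemma borel_measurable_label [measurable]: "(\<lambda>u. u i) \<in> borel_measurable label_measure"
  by (rule measurable_compose[OF measurable_label]) simp

lemma borel_measurable_peak [measurable]: "(\<lambda>u. peak u a k) \<in> borel_measurable label_measure"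
  unfolding peak_def by measurable

lemma measurable_peak_le: "Measurable.pred label_measure (\<lambda>u. peak u a k \<le> peak u b l)"
  using borel_measurable_le[OF borel_measurable_peak borel_measurable_peak] by (simp add: pred_def)

lemma measurable_forest_sites [measurable]:
  "Measurable.pred label_measure (\<lambda>u. x \<in> forest_sites p q u)"
proof -
  note less = borel_measurable_pred_less[OF borel_measurable_peak borel_measurable_peak]
    and le = measurable_peak_le
  have pos: "Measurable.pred label_measure (\<lambda>u. 0 < peak u a k)" for a k
    by measurable
  have zero: "Measurable.pred label_measure (\<lambda>u. peak u a k = 0)" for a k
    using pos[of a k] by (simp add: pred_def)
  show ?thesis
    unfolding forest_sites_def mem_Collect_eq
    by (intro pred_intros_logic pred_intros_countable less le pos zero) simp_all
qed

lemma measurable_forest_step [measurable]: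
  "Measurable.pred label_measure (\<lambda>u. forest_step p q u x = y)"
proof -
  have "(\<lambda>u. forest_step p q u x = y) = (\<lambda>u. (peak u p (x $ p) \<le> peak u q (x $ q) \<and> x + axis p 1 = y)
      \<or> (\<not> peak u p (x $ p) \<le> peak u q (x $ q) \<and> x + axis q 1 = y))"
    by (auto simp: forest_step_def fun_eq_iff)
  then show ?thesis
    using measurable_peak_le[of p _ q] by (auto intro!: pred_intros_logic)
qed

lemma measurable_forest_generation [measurable]:
  "(\<lambda>u. generation (forest_sites p q u) (forest_step p q u) n x) \<in> borel_measurable label_measure"
proof (induction n arbitrary: x)
  case 0
  show ?case unfolding generation.simps of_bool_def by measurable
next
  case (Suc n)
  note Suc [measurable]
  show ?case unfolding generation.simps by measurable
qed

lemma measurable_forest_config: "forest_config p q \<in> measurable label_measure config_algebra"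
  unfolding config_algebra_def
proof (rule measurable_PiM_single')
  show "(\<lambda>u. forest_config p q u x) \<in> borel_measurable label_measure" for x
    unfolding forest_config_def progeny_def by measurable
qed (auto simp: forest_config_def)

lemma measurable_config [measurable]: "(\<lambda>c. c x) \<in> borel_measurable config_algebra"
  unfolding config_algebra_def by (rule measurable_component_singleton) simp

lemma measurable_escaping [measurable]: "Measurable.pred config_algebra (escaping :: 'd::finite config \<Rightarrow> bool)"
proof -
  have "sum c (children c x) = (\<Sum>y\<in>nbhd x. if 0 < c y \<and> c y < c x then c y else 0)"
    for c :: "'d config" and x :: "'d site"
    unfolding children_def by (rule sum.inter_filter[OF finite_nbhd])
  note children_sum = this
  have less: "Measurable.pred config_algebra (\<lambda>c. c x < c y)" for x y :: "'d site"
    by (rule borel_measurable_pred_less) (rule measurable_config)+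
  have bounds: "Measurable.pred config_algebra (\<lambda>c. c x < \<top>)"
    "Measurable.pred config_algebra (\<lambda>c. 0 < c x)" for x :: "'d site"
    by (intro borel_measurable_pred_less measurable_config borel_measurable_const)+
  have "Measurable.pred config_algebra (\<lambda>c. 0 < c y \<and> c y < c x)" for x y :: "'d site"
    by (intro pred_intros_logic less bounds)
  then have "(\<lambda>c. if 0 < c y \<and> c y < c x then c y else 0) \<in> borel_measurable config_algebra"
    for x y :: "'d site"
    by (intro measurable_If measurable_config borel_measurable_const) (simp add: pred_def)
  then have le: "Measurable.pred config_algebra
      (\<lambda>c. 1 + (\<Sum>y\<in>nbhd x. if 0 < c y \<and> c y < c x then c y else 0) \<le> c x)" for x :: "'d site"
    unfolding pred_def
    by (intro borel_measurable_le borel_measurable_add borel_measurable_sum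
        measurable_config borel_measurable_const)
  show ?thesis
    unfolding escaping_def children_sum
    by (intro pred_intros_logic pred_intros_countable pred_intros_finite finite_nbhd
        less bounds le) simp_all
qed

lemma distr_shift_labels: "distr label_measure label_measure (shift_labels t) = label_measure"
proof -
  have "inj (\<lambda>(a, k). (a, k + t $ a))" by (auto simp: inj_on_def)
  then have "distr (PiM UNIV (\<lambda>_. measure_pmf (geometric_pmf (1/2)))) (PiM UNIV (\<lambda>_. measure_pmf (geometric_pmf (1/2))))
      (\<lambda>u. \<lambda>i\<in>UNIV. u ((\<lambda>(a, k). (a, k + t $ a)) i)) = PiM UNIV (\<lambda>_. measure_pmf (geometric_pmf (1/2)))"
    by (intro distr_PiM_reindex) (auto intro: prob_space_measure_pmf)
  moreover have "(\<lambda>u :: 'a \<times> int \<Rightarrow> nat. \<lambda>i\<in>UNIV. u ((\<lambda>(a, k). (a, k + t $ a)) i)) = shift_labels t"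
    by (auto simp: shift_labels_def fun_eq_iff)
  ultimately show ?thesis by (simp add: label_measure_def)
qed

lemma measurable_shift_labels: "shift_labels t \<in> measurable label_measure label_measure"
proof -
  have "(\<lambda>u. shift_labels t u i) \<in> measurable label_measure (measure_pmf (geometric_pmf (1/2)))" for i
    unfolding measurable_pmf_measure2 shift_labels_def by (cases i) simp
  then show ?thesis
    unfolding label_measure_def by (intro measurable_PiM_single') auto
qed

lemma measurable_shift_config: "(\<lambda>c x. c (x + t)) \<in> measurable config_algebra config_algebra"
  unfolding config_algebra_def by (intro measurable_PiM_single') (auto simp: config_algebra_def[symmetric])

lemma translation_invariant_forest_config:
  "translation_invariant_distribution (distr label_measure config_algebra (forest_config p q))"
  unfolding translation_invariant_distribution_def
proof (intro conjI allI)
  show "prob_space (distr label_measure config_algebra (forest_config p q))"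
    by (rule prob_space.prob_space_distr[OF prob_space_label_measure measurable_forest_config])
  fix t
  have "distr (distr label_measure config_algebra (forest_config p q)) config_algebra (\<lambda>c x. c (x + t))
      = distr label_measure config_algebra (forest_config p q \<circ> shift_labels t)"
    by (subst distr_distr[OF measurable_shift_config measurable_forest_config])
       (auto intro!: arg_cong[of _ _ "distr _ _"] simp: fun_eq_iff forest_config_shift)
  also have "\<dots> = distr (distr label_measure label_measure (shift_labels t)) config_algebra (forest_config p q)"
    by (rule distr_distr[OF measurable_forest_config measurable_shift_labels, symmetric])
  finally show "distr (distr label_measure config_algebra (forest_config p q)) config_algebra (\<lambda>c x. c (x + t))
      = distr label_measure config_algebra (forest_config p q)"
    by (simp add: distr_shift_labels)
qed simp

text \<open>
  With positive probability, each hyperplane through \<open>x\<close> has label \<open>1\<close> between two labels \<open>0\<close>;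
  then all heights at \<open>x\<close> are positive and \<open>x\<close> belongs to the forest.
\<close>
lemma forest_site_not_null:
  "\<not> (AE u in label_measure. x \<notin> forest_sites p q u)"
proof
  assume *: "AE u in label_measure. x \<notin> forest_sites p q u"
  define J where "J = (SIGMA a:UNIV. {x $ a - 1..x $ a + 1})"
  define X :: "'a \<times> int \<Rightarrow> nat set" where "X = (\<lambda>(a, k). if k = x $ a then {1} else {0})"
  let ?E = "{u \<in> space label_measure. \<forall>i\<in>J. u i \<in> X i}"
  have site: "x \<in> forest_sites p q u" if u: "\<And>i. i \<in> J \<Longrightarrow> u i \<in> X i" for u
  proof -
    have "u (a, x $ a) = 1 \<and> u (a, x $ a - 1) = 0 \<and> u (a, x $ a + 1) = 0" for a
      using u[of "(a, x $ a)"] u[of "(a, x $ a - 1)"] u[of "(a, x $ a + 1)"] by (auto simp: J_def X_def)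
    then have "peak u a (x $ a) = 1" for a by (simp add: peak_def)
    then show ?thesis by (simp add: forest_sites_def)
  qed
  have "AE u in label_measure. u \<notin> ?E"
    using * by eventually_elim (use site in blast)
  then have "emeasure label_measure ?E = 0"
    by (subst (asm) AE_iff_measurable[where N = ?E]) (auto simp: J_def)
  moreover have "emeasure label_measure ?E = (\<Prod>i\<in>J. emeasure (geometric_pmf (1/2)) (X i))"
    unfolding label_measure_def by (rule labels.emeasure_PiM_Collect) (auto simp: J_def)
  moreover have "emeasure (geometric_pmf (1/2)) (X i) \<noteq> 0" for i
    by (auto simp: X_def emeasure_pmf_single split: prod.split)
  ultimately show False by (simp add: J_def)
qed

lemma exists_two_elements:
  assumes "CARD('d::finite) \<ge> 2"
  shows "\<exists>p q :: 'd::finite. p \<noteq> q"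
proof (rule ccontr)
  assume "\<not> ?thesis"
  then have "(UNIV :: 'd set) = {undefined}" by auto
  then have "CARD('d) = 1" by (metis card_1_singleton_iff One_nat_def)
  then show False using assms by simp
qed

theorem theorem1:
  assumes "CARD('d::finite) \<ge> 2"
  shows "\<exists>\<mu> :: 'd config measure. translation_invariant_distribution \<mu> \<and>
    (\<forall>x. (AE (c, w) in \<mu> \<Otimes>\<^sub>M tie_breaking. convergent (\<lambda>n. clustering c w n x)) \<and>
         (\<integral>\<^sup>+ (c, w). lim (\<lambda>n. clustering c w n x) \<partial>(\<mu> \<Otimes>\<^sub>M tie_breaking))
           < (\<integral>\<^sup>+ (c, w). clustering c w 0 x \<partial>(\<mu> \<Otimes>\<^sub>M tie_breaking)))"
proof -
  obtain p q :: 'd where pq: "p \<noteq> q" using exists_two_elements[OF assms] by blast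
  define \<mu> where "\<mu> = distr label_measure config_algebra (forest_config p q)"
  let ?M = "\<mu> \<Otimes>\<^sub>M (tie_breaking :: (nat \<times> 'd site \<times> 'd site set \<Rightarrow> 'd site) measure)"
  have inv: "translation_invariant_distribution \<mu>"
    unfolding \<mu>_def by (rule translation_invariant_forest_config)
  interpret \<mu>: prob_space \<mu> using inv by (simp add: translation_invariant_distribution_def)
  interpret T: prob_space "tie_breaking :: (nat \<times> 'd site \<times> 'd site set \<Rightarrow> 'd site) measure"
    by (rule prob_space_tie_breaking)
  interpret pair_sigma_finite \<mu> "tie_breaking :: (nat \<times> 'd site \<times> 'd site set \<Rightarrow> 'd site) measure" ..
  have sets_\<mu> [measurable_cong]: "sets \<mu> = sets config_algebra" by (simp add: \<mu>_def)
  have "AE u in label_measure. escaping (forest_config p q u)"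
    using AE_induced_forest[OF pq]
    by eventually_elim (simp add: forest_config_def induced_forest.escaping_progeny)
  then have "AE c in \<mu>. escaping c"
    unfolding \<mu>_def by (subst AE_distr_iff[OF measurable_forest_config]) auto
  then have "AE z in ?M. escaping (fst z)"
    by (intro AE_pair_measure) auto
  then have limit: "AE (c, w) in ?M. (\<lambda>n. clustering c w n x) \<longlonglongrightarrow> 0" for x
    using AE_space
  proof eventually_elim
    case (elim z)
    obtain c w where z: "z = (c, w)" by (cases z)
    have "w \<in> space tie_breaking" using elim(2) by (simp add: z space_pair_measure)
    then show ?case
      using elim(1) flow_tendsto_0[of c x] by (simp add: z clustering_eq_flow)
  qed
  have "(\<integral>\<^sup>+ (c, w). lim (\<lambda>n. clustering c w n x) \<partial>?M) < (\<integral>\<^sup>+ (c, w). clustering c w 0 x \<partial>?M)" for x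
  proof -
    have "(\<integral>\<^sup>+ (c, w). lim (\<lambda>n. clustering c w n x) \<partial>?M) = (\<integral>\<^sup>+ z. 0 \<partial>?M)"
      using limit[of x] by (intro nn_integral_cong_AE) (auto dest: limI)
    moreover have "(\<integral>\<^sup>+ (c, w). clustering c w 0 x \<partial>?M) = (\<integral>\<^sup>+ u. forest_config p q u x \<partial>label_measure)"
    proof -
      have "(\<integral>\<^sup>+ (c, w). clustering c w 0 x \<partial>?M) = (\<integral>\<^sup>+ c. c x \<partial>\<mu>)"
        by (subst T.nn_integral_fst[symmetric]) (simp_all add: T.emeasure_space_1 split_beta')
      also have "\<dots> = (\<integral>\<^sup>+ u. forest_config p q u x \<partial>label_measure)"
        unfolding \<mu>_def by (rule nn_integral_distr[OF measurable_forest_config]) simp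
      finally show ?thesis .
    qed
    moreover have "(\<integral>\<^sup>+ u. forest_config p q u x \<partial>label_measure) \<noteq> 0"
    proof
      assume "(\<integral>\<^sup>+ u. forest_config p q u x \<partial>label_measure) = 0"
      then have "AE u in label_measure. forest_config p q u x = 0"
        by (subst (asm) nn_integral_0_iff_AE)
           (auto intro: measurable_compose[OF measurable_forest_config measurable_config])
      then have "AE u in label_measure. x \<notin> forest_sites p q u"
        using AE_induced_forest[OF pq]
      proof eventually_elim
        case (elim u)
        then show ?case
          using induced_forest.progeny_pos_iff[OF elim(2), of x] by (simp add: forest_config_def)
      qed
      then show False by (rule forest_site_not_null[THEN notE])
    qed
    ultimately show ?thesis by (simp add: zero_less_iff_neq_zero)
  qed
  moreover have "AE (c, w) in ?M. convergent (\<lambda>n. clustering c w n x)" for x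
    using limit[of x] by eventually_elim (auto simp: convergent_def)
  ultimately show ?thesis using inv by blast
qed

end
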